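(* Let $\xi \in \mathbb{K}^n$, where $n \ge 2$. Suppose $x \in \mathbb{K}^n$ is a vector with distinct components such that $$\left\| \frac{x-\xi}{d(x)} \right\|_p \le \frac{R}{1+bR}$$ for some $1 \le p \le \infty$ and $R > 0$, where $b = 2^{1/q}$ and $q$ is the conjugate exponent of $p$. Then $\xi$ has pairwise distinct components and $$\left\| \frac{x-\xi}{d(\xi)} \right\|_p \le R.$$ Besides, if the first inequality is strict, then the second inequality is strict too.
   Context: $(\mathbb{K},|\cdot|)$ is an algebraically closed normed field (a field with an absolute value). For $1 \le p \le \infty$, the $p$-norm on $\mathbb{K}^n$ and on $\mathbb{R}^n$ is $\|x\|_p = \left(\sum_{i=1}^n |x_i|^p\right)^{1/p}$ ($\|x\|_\infty = \max_i |x_i|$). The conjugate exponent $q$ of $p$ is defined by $1 \le q \le \infty$ and $1/p+1/q=1$ (with $1/\infty = 0$). For $x \in \mathbb{K}^n$, $d(x) = (d_1(x),\ldots,d_n(x)) \in \mathbb{R}^n$ with $d_i(x) = \min_{j\ne i}|x_i-x_j|$. For $x \in \mathbb{K}^n$ and $y \in \mathbb{R}^n$ with no zero components, $\frac{x}{y} = \left(\frac{|x_1|}{y_1},\ldots,\frac{|x_n|}{y_n}\right) \in \mathbb{R}^n$. *)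

theory Defs
  imports "HOL-Analysis.Analysis" "HOL-Computational_Algebra.Computational_Algebra"
begin

text \<open>
  The absolute value is an explicit real-valued function, because \<^class>\<open>real_normed_field\<close>
  would exclude the non-archimedean and positive-characteristic cases.
\<close>

locale absolute_value =
  fixes v :: "'k::field \<Rightarrow> real"
  assumes nonneg: "0 \<le> v x"
    and eq_zero_iff: "v x = 0 \<longleftrightarrow> x = 0"
    and mult: "v (x * y) = v x * v y"
    and triangle: "v (x + y) \<le> v x + v y"

definition pnorm :: "('a \<Rightarrow> real) \<Rightarrow> ereal \<Rightarrow> 'a ^ 'n::finite \<Rightarrow> real" where
  "pnorm v p x =
     (if p = \<infinity> then Max (range (\<lambda>i. v (x $ i)))
      else (\<Sum>i\<in>UNIV. v (x $ i) powr real_of_ereal p) powr (1 / real_of_ereal p))"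

text \<open>In \<^typ>\<open>ereal\<close>, \<open>1 / \<infinity> = 0\<close>, so \<open>1\<close> and \<open>\<infinity>\<close> are conjugate to each other.\<close>

definition conjugate_exponent :: "ereal \<Rightarrow> ereal \<Rightarrow> bool" where
  "conjugate_exponent p q \<longleftrightarrow> 1 \<le> q \<and> 1 / p + 1 / q = 1"

definition min_dist :: "('k::field \<Rightarrow> real) \<Rightarrow> 'k ^ 'n::finite \<Rightarrow> real ^ 'n" where
  "min_dist v x = (\<chi> i. Min {v (x $ i - x $ j) |j. j \<noteq> i})"

definition vec_quot :: "('k \<Rightarrow> real) \<Rightarrow> 'k ^ 'n::finite \<Rightarrow> real ^ 'n \<Rightarrow> real ^ 'n" where
  "vec_quot v x y = (\<chi> i. v (x $ i) / y $ i)"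

definition distinct_components :: "'a ^ 'n::finite \<Rightarrow> bool" where
  "distinct_components x \<longleftrightarrow> (\<forall>i j. i \<noteq> j \<longrightarrow> x $ i \<noteq> x $ j)"

end

theory Submission
  imports Defs
begin

text \<open>
  Put \<open>u\<^sub>i = |x\<^sub>i - \<xi>\<^sub>i| / d\<^sub>i(x)\<close> and let \<open>m\<close> be the \<open>p\<close>-norm of \<open>u\<close>. The whole argument rests on
  \<open>\<xi>\<close> being at least as well separated as \<open>x\<close> up to the factor \<open>1 - b m\<close>. For \<open>i \<noteq> j\<close> both \<open>d\<^sub>i(x)\<close>
  and \<open>d\<^sub>j(x)\<close> are at most \<open>|x\<^sub>i - x\<^sub>j|\<close>, so the triangle inequality gives
  \<open>|\<xi>\<^sub>i - \<xi>\<^sub>j| \<ge> |x\<^sub>i - x\<^sub>j| - u\<^sub>i d\<^sub>i(x) - u\<^sub>j d\<^sub>j(x) \<ge> (1 - u\<^sub>i - u\<^sub>j) |x\<^sub>i - x\<^sub>j|\<close>. By Hoelder's inequality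
  for two terms (\<open>add_le_conjugate_pnorm\<close>), \<open>u\<^sub>i + u\<^sub>j \<le> 2\<^sup>1\<^sup>/\<^sup>q m = b m\<close>, and hence
  \<open>|\<xi>\<^sub>i - \<xi>\<^sub>j| \<ge> (1 - b m) d\<^sub>i(x)\<close> (\<open>separation_lower_bound\<close>).

  The hypothesis \<open>m \<le> R / (1 + b R)\<close> makes \<open>b m < 1\<close>. The components of \<open>\<xi>\<close> are therefore distinct
  and \<open>d\<^sub>i(\<xi>) \<ge> (1 - b m) d\<^sub>i(x)\<close>. Monotonicity and homogeneity of the \<open>p\<close>-norm bound the second norm
  by \<open>m / (1 - b m)\<close>, which is at most \<open>R\<close> exactly when \<open>m \<le> R / (1 + b R)\<close>; the same equivalence
  holds for the strict inequalities.
\<close>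

text \<open>Without this, every \<open>$\<close> could also be read as a power series coefficient.\<close>

no_notation fps_nth (infixl \<open>$\<close> 75)

lemma pnorm_abs_mono:
  fixes x y :: "real ^ 'n::finite"
  assumes "1 \<le> p" and le: "\<And>i. \<bar>x $ i\<bar> \<le> \<bar>y $ i\<bar>"
  shows "pnorm abs p x \<le> pnorm abs p y"
proof (cases "p = \<infinity>")
  case True
  have "\<bar>x $ i\<bar> \<le> Max (range (\<lambda>i. \<bar>y $ i\<bar>))" for i
    by (rule order_trans[OF le]) simp
  then show ?thesis
    using True by (simp add: pnorm_def)
next
  case False
  then obtain r where "p = ereal r" "1 \<le> r"
    using assms(1) by (cases p) auto
  then show ?thesis
    by (simp add: pnorm_def powr_mono2 sum_mono sum_nonneg le)
qed

lemma pnorm_abs_scaleR: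
  fixes x :: "real ^ 'n::finite"
  assumes "1 \<le> p" "0 \<le> c"
  shows "pnorm abs p (c *\<^sub>R x) = c * pnorm abs p x"
proof (cases "p = \<infinity>")
  case True
  have "mono ((*) c)"
    using assms(2) by (simp add: mono_def mult_left_mono)
  then have "c * Max (range (\<lambda>i. \<bar>x $ i\<bar>)) = Max ((*) c ` range (\<lambda>i. \<bar>x $ i\<bar>))"
    by (rule mono_Max_commute) auto
  then show ?thesis
    using True assms(2) by (simp add: pnorm_def abs_mult image_image)
next
  case False
  then obtain r where r: "p = ereal r" "1 \<le> r"
    using assms(1) by (cases p) auto
  have "(\<Sum>i\<in>UNIV. \<bar>c * x $ i\<bar> powr r) = c powr r * (\<Sum>i\<in>UNIV. \<bar>x $ i\<bar> powr r)"
    using assms(2) by (simp add: abs_mult powr_mult sum_distrib_left)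
  then show ?thesis
    using r assms(2) by (simp add: pnorm_def powr_mult sum_nonneg powr_powr)
qed

text \<open>
  The power mean inequality for two terms, from convexity of \<open>t \<mapsto> t\<^sup>r\<close>. The fact
  \<open>powr_convex\<close> speaks of the open half-line, so a vanishing term is treated separately: there
  \<open>1 \<le> 2\<^sup>r\<^sup>-\<^sup>1\<close> suffices.
\<close>

lemma add_powr_le:
  fixes a c r :: real
  assumes "0 \<le> a" "0 \<le> c" "1 \<le> r"
  shows "(a + c) powr r \<le> 2 powr (r - 1) * (a powr r + c powr r)"
proof (cases "a = 0 \<or> c = 0")
  case True
  have "1 \<le> (2::real) powr (r - 1)"
    using assms(3) by (simp add: ge_one_powr_ge_zero)
  then have "t powr r \<le> 2 powr (r - 1) * t powr r" for t :: real
    using mult_right_mono[of 1 "2 powr (r - 1)" "t powr r"] by simp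
  then show ?thesis
    using True by auto
next
  case False
  then have pos: "0 < a" "0 < c"
    using assms by auto
  have "((1 - 1/2) *\<^sub>R a + (1/2) *\<^sub>R c) powr r \<le> (1 - 1/2) * a powr r + (1/2) * c powr r"
    by (rule convex_onD[OF powr_convex[OF assms(3)]]) (use pos in auto)
  then have "((a + c) / 2) powr r \<le> (a powr r + c powr r) / 2"
    by (simp add: add_divide_distrib)
  then have "(a + c) powr r / 2 powr r \<le> (a powr r + c powr r) / 2"
    using pos by (simp add: powr_divide)
  then show ?thesis
    by (simp add: powr_diff field_simps)
qed

text \<open>
  Hoelder's inequality for the vector \<open>x\<close> and the indicator of \<open>{i, j}\<close>, whose \<open>q\<close>-norm
  is \<open>2\<^sup>1\<^sup>/\<^sup>q\<close>.
\<close>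

lemma add_le_conjugate_pnorm:
  fixes x :: "real ^ 'n::finite"
  assumes "1 \<le> p" "conjugate_exponent p q" "i \<noteq> j"
  shows "\<bar>x $ i\<bar> + \<bar>x $ j\<bar> \<le> 2 powr real_of_ereal (1 / q) * pnorm abs p x"
proof (cases "p = \<infinity>")
  case True
  then have "1 / q = 1"
    using assms(2) by (simp add: conjugate_exponent_def)
  moreover have "\<bar>x $ k\<bar> \<le> Max (range (\<lambda>i. \<bar>x $ i\<bar>))" for k
    by simp
  from this[of i] this[of j]
  have "\<bar>x $ i\<bar> + \<bar>x $ j\<bar> \<le> 2 * Max (range (\<lambda>i. \<bar>x $ i\<bar>))"
    by linarith
  ultimately show ?thesis
    using True by (simp add: pnorm_def)
next
  case False
  then obtain r where r: "p = ereal r" "1 \<le> r"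
    using assms(1) by (cases p) auto
  have "1 / p = ereal (1 / r)"
    using r by (simp add: one_ereal_def)
  then have "ereal (1 / r) + 1 / q = 1"
    using assms(2) by (simp add: conjugate_exponent_def)
  then have q: "real_of_ereal (1 / q) = 1 - 1 / r"
    by (cases "1 / q") (auto simp: one_ereal_def)
  let ?a = "\<bar>x $ i\<bar>" and ?c = "\<bar>x $ j\<bar>" and ?S = "\<Sum>k\<in>UNIV. \<bar>x $ k\<bar> powr r"
  have "?a powr r + ?c powr r = (\<Sum>k\<in>{i, j}. \<bar>x $ k\<bar> powr r)"
    using assms(3) by simp
  also have "\<dots> \<le> ?S"
    by (rule sum_mono2) auto
  finally have "2 powr (r - 1) * (?a powr r + ?c powr r) \<le> 2 powr (r - 1) * ?S"
    by simp
  with add_powr_le[of ?a ?c r] r(2) have "(?a + ?c) powr r \<le> 2 powr (r - 1) * ?S"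
    by linarith
  then have "((?a + ?c) powr r) powr (1 / r) \<le> (2 powr (r - 1) * ?S) powr (1 / r)"
    using r by (intro powr_mono2) auto
  moreover have "(r - 1) * (1 / r) = 1 - 1 / r"
    using r by (simp add: field_simps)
  ultimately show ?thesis
    using r q by (simp add: powr_powr powr_mult sum_nonneg pnorm_def)
qed

context absolute_value
begin

lemma v_minus: "v (- x) = v x"
proof -
  have "v (- 1) * v (- 1) = v 1 * v 1"
    by (simp flip: mult)
  then have "v (- 1) = v 1"
    using nonneg[of "- 1"] nonneg[of 1] by (simp add: power2_eq_iff_nonneg flip: power2_eq_square)
  then show ?thesis
    using mult[of "- 1" x] mult[of 1 x] by simp
qed

lemma v_minus_commute: "v (x - y) = v (y - x)"
  using v_minus[of "x - y"] by simp

lemma min_dist_le: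
  fixes x :: "'k ^ 'n::finite"
  assumes "j \<noteq> i"
  shows "min_dist v x $ i \<le> v (x $ i - x $ j)"
  unfolding min_dist_def using assms by (auto intro!: Min_le)

text \<open>A second index is needed for the minimum to range over a nonempty set.\<close>

lemma min_dist_attained:
  fixes x :: "'k ^ 'n::finite"
  assumes "2 \<le> CARD('n)"
  obtains j where "j \<noteq> i" "min_dist v x $ i = v (x $ i - x $ j)"
proof -
  let ?D = "{v (x $ i - x $ j) |j. j \<noteq> i}"
  have "UNIV \<noteq> {i}"
    using assms by (metis card_1_singleton_iff One_nat_def numeral_le_one_iff semiring_norm(69))
  then have "?D \<noteq> {}"
    by auto
  then have "Min ?D \<in> ?D"
    by (intro Min_in) auto
  then show ?thesis
    using that by (auto simp: min_dist_def)
qed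

lemma min_dist_pos:
  fixes x :: "'k ^ 'n::finite"
  assumes "2 \<le> CARD('n)" "distinct_components x"
  shows "0 < min_dist v x $ i"
proof -
  obtain j where "j \<noteq> i" "min_dist v x $ i = v (x $ i - x $ j)"
    using min_dist_attained[OF assms(1)] .
  moreover have "v (x $ i - x $ j) \<noteq> 0"
    using assms(2) \<open>j \<noteq> i\<close> by (simp add: eq_zero_iff distinct_components_def)
  ultimately show ?thesis
    using nonneg[of "x $ i - x $ j"] by simp
qed

text \<open>
  Moving \<open>x\<^sub>i\<close> and \<open>x\<^sub>j\<close> to \<open>\<xi>\<^sub>i\<close> and \<open>\<xi>\<^sub>j\<close> shrinks their distance by at most the proportion
  \<open>u\<^sub>i + u\<^sub>j\<close>, because the displacements are measured relative to distances \<open>d\<^sub>i(x)\<close> and \<open>d\<^sub>j(x)\<close> that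
  do not exceed \<open>|x\<^sub>i - x\<^sub>j|\<close>.
\<close>

lemma separation_lower_bound:
  fixes x \<xi> :: "'k ^ 'n::finite"
  defines "u \<equiv> vec_quot v (x - \<xi>) (min_dist v x)"
  assumes "2 \<le> CARD('n)" "distinct_components x" "1 \<le> p" "conjugate_exponent p q"
    and "i \<noteq> j" and le1: "2 powr real_of_ereal (1 / q) * pnorm abs p u \<le> 1"
  shows "(1 - 2 powr real_of_ereal (1 / q) * pnorm abs p u) * min_dist v x $ i
           \<le> v (\<xi> $ i - \<xi> $ j)"
proof -
  let ?B = "2 powr real_of_ereal (1 / q) * pnorm abs p u"
  let ?D = "v (x $ i - x $ j)"
  have dpos: "0 < min_dist v x $ k" for k
    using min_dist_pos[OF assms(2,3)] .
  have u_nonneg: "0 \<le> u $ k" for k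
    using dpos[of k] by (simp add: u_def vec_quot_def nonneg)
  have displacement: "v (x $ k - \<xi> $ k) = u $ k * min_dist v x $ k" for k
    using dpos[of k] by (simp add: u_def vec_quot_def)
  have "u $ i + u $ j \<le> ?B"
    using add_le_conjugate_pnorm[OF assms(4,5,6), of u] u_nonneg by simp
  have "min_dist v x $ i \<le> ?D"
    using min_dist_le assms(6) by metis
  have "min_dist v x $ j \<le> ?D"
    using min_dist_le[OF assms(6), of x] v_minus_commute by simp
  have "(1 - ?B) * min_dist v x $ i \<le> (1 - ?B) * ?D"
    using \<open>min_dist v x $ i \<le> ?D\<close> le1 by (simp add: mult_left_mono)
  also have "\<dots> \<le> (1 - (u $ i + u $ j)) * ?D"
    using \<open>u $ i + u $ j \<le> ?B\<close> nonneg by (intro mult_right_mono) auto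
  also have "\<dots> = ?D - u $ i * ?D - u $ j * ?D"
    by (simp add: algebra_simps)
  also have "\<dots> \<le> ?D - v (x $ i - \<xi> $ i) - v (x $ j - \<xi> $ j)"
    using mult_left_mono[OF \<open>min_dist v x $ i \<le> ?D\<close> u_nonneg[of i]]
      mult_left_mono[OF \<open>min_dist v x $ j \<le> ?D\<close> u_nonneg[of j]]
    by (simp add: displacement)
  also have "\<dots> \<le> v (\<xi> $ i - \<xi> $ j)"
  proof -
    have "x $ i - x $ j = (x $ i - \<xi> $ i) + ((\<xi> $ i - \<xi> $ j) + (\<xi> $ j - x $ j))"
      by simp
    then have "?D \<le> v (x $ i - \<xi> $ i) + (v (\<xi> $ i - \<xi> $ j) + v (\<xi> $ j - x $ j))"
      using triangle by (metis add_left_mono order_trans)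
    then show ?thesis
      using v_minus_commute[of "\<xi> $ j" "x $ j"] by simp
  qed
  finally show ?thesis .
qed

end

theorem theorem4p2:
  fixes v :: "'k::alg_closed_field \<Rightarrow> real"
    and \<xi> x :: "'k ^ 'n::finite"
    and p q :: ereal
    and b R :: real
  assumes "absolute_value v"
    and "CARD('n) \<ge> 2"
    and "distinct_components x"
    and "1 \<le> p" and "conjugate_exponent p q" and "b = 2 powr real_of_ereal (1 / q)"
    and "R > 0"
    and "pnorm abs p (vec_quot v (x - \<xi>) (min_dist v x)) \<le> R / (1 + b * R)"
  shows "distinct_components \<xi> \<and>
    pnorm abs p (vec_quot v (x - \<xi>) (min_dist v \<xi>)) \<le> R \<and>
    (pnorm abs p (vec_quot v (x - \<xi>) (min_dist v x)) < R / (1 + b * R) \<longrightarrow>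
     pnorm abs p (vec_quot v (x - \<xi>) (min_dist v \<xi>)) < R)"
proof -
  interpret absolute_value v
    by fact
  define u where "u = vec_quot v (x - \<xi>) (min_dist v x)"
  define w where "w = vec_quot v (x - \<xi>) (min_dist v \<xi>)"
  define m where "m = pnorm abs p u"
  have "0 < b"
    using assms(6) by simp
  then have "0 < 1 + b * R"
    using assms(7) by (simp add: add_pos_pos)
  have m_le: "m \<le> R / (1 + b * R)"
    using assms(8) by (simp add: m_def u_def)
  have "b * m \<le> b * (R / (1 + b * R))"
    using m_le \<open>0 < b\<close> by (intro mult_left_mono) auto
  also have "\<dots> < 1"
    using \<open>0 < 1 + b * R\<close> by (simp add: field_simps)
  finally have "b * m < 1" .
  then have pos: "0 < 1 - b * m"
    by simp
  have dx: "0 < min_dist v x $ i" for i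
    using min_dist_pos[OF assms(2,3)] .
  have sep: "(1 - b * m) * min_dist v x $ i \<le> v (\<xi> $ i - \<xi> $ j)" if "i \<noteq> j" for i j
    using separation_lower_bound[OF assms(2-5) that, of \<xi>] \<open>b * m < 1\<close>
    by (simp add: m_def u_def assms(6))
  have "distinct_components \<xi>"
    unfolding distinct_components_def
  proof (intro allI impI)
    fix i j :: 'n
    assume "i \<noteq> j"
    then have "0 < v (\<xi> $ i - \<xi> $ j)"
      using sep[of i j] mult_pos_pos[OF pos dx[of i]] by linarith
    then show "\<xi> $ i \<noteq> \<xi> $ j"
      using eq_zero_iff[of 0] by auto
  qed
  have d\<xi>: "(1 - b * m) * min_dist v x $ i \<le> min_dist v \<xi> $ i" for i
  proof -
    obtain j where "j \<noteq> i" "min_dist v \<xi> $ i = v (\<xi> $ i - \<xi> $ j)"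
      using min_dist_attained[OF assms(2)] .
    then show ?thesis
      using sep[of i j] by simp
  qed
  have "\<bar>w $ i\<bar> \<le> \<bar>((1 / (1 - b * m)) *\<^sub>R u) $ i\<bar>" for i
  proof -
    have "v ((x - \<xi>) $ i) / min_dist v \<xi> $ i
            \<le> v ((x - \<xi>) $ i) / ((1 - b * m) * min_dist v x $ i)"
      using d\<xi> pos dx nonneg
      by (intro divide_left_mono) (auto intro!: mult_pos_pos min_dist_pos assms \<open>distinct_components \<xi>\<close>)
    moreover have "0 \<le> w $ i"
      using min_dist_pos[OF assms(2) \<open>distinct_components \<xi>\<close>, of i] nonneg
      by (simp add: w_def vec_quot_def)
    moreover have "((1 / (1 - b * m)) *\<^sub>R u) $ i
                     = v ((x - \<xi>) $ i) / ((1 - b * m) * min_dist v x $ i)"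
      by (simp add: u_def vec_quot_def)
    moreover have "w $ i = v ((x - \<xi>) $ i) / min_dist v \<xi> $ i"
      by (simp add: w_def vec_quot_def)
    ultimately show ?thesis
      by linarith
  qed
  then have "pnorm abs p w \<le> pnorm abs p ((1 / (1 - b * m)) *\<^sub>R u)"
    using assms(4) by (intro pnorm_abs_mono)
  also have "\<dots> = m / (1 - b * m)"
    using pos assms(4) by (simp add: pnorm_abs_scaleR m_def)
  finally have w_le: "pnorm abs p w \<le> m / (1 - b * m)" .
  \<comment> \<open>Cleared of denominators, both sides of the equivalence read \<open>m + b m R \<le> R\<close>.\<close>
  have "m / (1 - b * m) \<le> R \<longleftrightarrow> m \<le> R / (1 + b * R)"
    using pos \<open>0 < 1 + b * R\<close> by (simp add: pos_divide_le_eq pos_le_divide_eq algebra_simps)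
  moreover have "m / (1 - b * m) < R \<longleftrightarrow> m < R / (1 + b * R)"
    using pos \<open>0 < 1 + b * R\<close> by (simp add: pos_divide_less_eq pos_less_divide_eq algebra_simps)
  ultimately show ?thesis
    using \<open>distinct_components \<xi>\<close> w_le m_le unfolding m_def u_def w_def by linarith
qed

end
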